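(* Let $\mathcal{G}^{\mathrm{MBQP}}$ be a mixed-binary quadratic game and $\mathcal{G}^{\mathrm{CPP}}$ its completely positive reformulation. (1) If $\mathbf{x}^*$ is a pure-strategy Nash equilibrium (PNE) of $\mathcal{G}^{\mathrm{MBQP}}$, then $(\mathbf{x}_i^*,\mathbf{x}_i^*\mathbf{x}_i^{*\top})_{i\in\mathcal{I}}$ is a PNE of $\mathcal{G}^{\mathrm{CPP}}$. (2) Conversely, if $(\mathbf{x}_i^*,X_i^* )_{i\in\mathcal{I}}$ is a PNE of $\mathcal{G}^{\mathrm{CPP}}$, and if for every $i\in\mathcal{I}$ one has $Q^{(i)}_{ii}\succeq0$ and $x^*_{ik}\in\{0,1\}$ for all $k\in\mathcal{B}_i$, then $\mathbf{x}^*=(\mathbf{x}^*_i)_{i\in\mathcal{I}}$ is a PNE of $\mathcal{G}^{\mathrm{MBQP}}$.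
   Context: **Notation.** $\mathcal{C}_n^*=\{XX^\top: X\in\mathbb{R}^{n\times r}_+\text{ for some }r\}$ is the completely positive cone. $\mathbf{e}_l$ is the $l$-th unit vector. $\mathrm{opt}(\cdot)$ is the optimal value of a problem. **Game $\mathcal{G}^{\mathrm{MBQP}}$.** $\mathcal{I}$ is a finite set of players; player $i$ chooses $\mathbf{x}_i\in\mathbb{R}^{n_i}$; $\mathbf{x}=(\mathbf{x}_i)_{i\in\mathcal{I}}$, and $\mathbf{x}_{-i}$ denotes the strategies of all players other than $i$. Given $\mathbf{x}_{-i}$, player $i$ solves $$\mathcal{P}_i^{\mathrm{MBQP}}(\mathbf{x}_{-i}):\quad \min_{\mathbf{x}_i}\ f_i(\mathbf{x}_i,\mathbf{x}_{-i})=\mathbf{x}^\top Q^{(i)}\mathbf{x}+2\mathbf{c}^{(i)\top}\mathbf{x}$$ $$\text{s.t. } \mathbf{a}_j^{(i)\top}\mathbf{x}_i=b_j^{(i)},\ j=1,\dots,m_i;\quad x_{ik}\in\{0,1\},\ k\in\mathcal{B}_i;\quad \mathbf{x}_i\in\mathbb{R}^{n_i}_+,$$ where $\mathcal{B}_i\subseteq\{1,\dots,n_i\}$ and $Q^{(i)}$ is a real symmetric matrix (of order $\sum_{i}n_i$), with blocks $Q^{(i)}_{ii}$, $Q^{(i)}_{-i,i}$, $Q^{(i)}_{-i,-i}$ according to the partition of $\mathbf{x}$ into $\mathbf{x}_i$ and $\mathbf{x}_{-i}$. The feasible set $\mathcal{X}_i$ is the strategy set of player $i$. A PNE of $\mathcal{G}^{\mathrm{MBQP}}$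 is $\mathbf{x}^*$ with $\mathbf{x}_i^*\in\mathcal{X}_i$ and $f_i(\mathbf{x}_i^*,\mathbf{x}_{-i}^* )=\mathrm{opt}(\mathcal{P}_i^{\mathrm{MBQP}}(\mathbf{x}_{-i}^* ))$ for all $i\in\mathcal{I}$. **Standing assumptions.** For each player $i$, the strategy set $\mathcal{X}_i$ is bounded, and property (KP) holds: there is $\mathbf{y}\in\mathbb{R}^{m_i}$ with $\sum_jy_j\mathbf{a}_j^{(i)}\ge\mathbf{0}$ and $\sum_jy_jb_j^{(i)}=1$. Fix such $\mathbf{y}$ and set $\boldsymbol\alpha^{(i)}=\sum_jy_j\mathbf{a}_j^{(i)}$. **Game $\mathcal{G}^{\mathrm{CPP}}$.** Player $i$ chooses $(\mathbf{x}_i,X_i)$ with $\mathbf{x}_i\in\mathbb{R}^{n_i}$ and $X_i$ a symmetric $n_i\times n_i$ matrix; given $\mathbf{x}_{-i}$, player $i$ solves $$\mathcal{P}_i^{\mathrm{CPP}}(\mathbf{x}_{-i}):\quad\min_{\mathbf{x}_i,X_i}\ F_i(\mathbf{x}_i,X_i,\mathbf{x}_{-i})=\mathrm{Tr}(Q^{(i)}_{ii}X_i)+2\mathbf{x}_{-i}^\top Q^{(i)}_{-i,i}\mathbf{x}_i+\mathbf{x}_{-i}^\top Q^{(i)}_{-i,-i}\mathbf{x}_{-i}+2\mathbf{c}^{(i)\top}\mathbf{x}$$ $$\text{s.t. } \mathbf{a}_j^{(i)\top}\mathbf{x}_i=b_j^{(i)},\ \ \mathbf{a}_j^{(i)\top}X_i\mathbf{a}_j^{(i)}=(b_j^{(i)})^2\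 (j=1,\dots,m_i);\quad x_{ik}=X_{i,kk}\ (k\in\mathcal{B}_i);$$ $$x_{il}=\mathrm{Tr}\left(\tfrac{\boldsymbol\alpha^{(i)}\mathbf{e}_l^\top+\mathbf{e}_l\boldsymbol\alpha^{(i)\top}}{2}X_i\right)\ (l=1,\dots,n_i);\quad X_i\in\mathcal{C}^*_{n_i}.$$ Its feasible set is the strategy set $\mathcal{X}_i'$. A PNE of $\mathcal{G}^{\mathrm{CPP}}$ is $(\mathbf{x}_i^*,X_i^* )_{i\in\mathcal{I}}$ with $(\mathbf{x}_i^*,X_i^* )\in\mathcal{X}_i'$ and $F_i(\mathbf{x}_i^*,X_i^*,\mathbf{x}_{-i}^* )=\mathrm{opt}(\mathcal{P}_i^{\mathrm{CPP}}(\mathbf{x}_{-i}^* ))$ for all $i\in\mathcal{I}$.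
   Formalization: Part (1) is false as stated; it is proved under the added assumption that, for every player i, the constraints a_j^T x_i = b_j (all j) and x_i ≥ 0 alone imply x_ik ≤ 1 for all k in B_i. Part (2) is proved without this assumption. *)

theory Defs
  imports "Jordan_Normal_Form.Matrix" "HOL-Library.Extended_Real"
begin

section \<open>Vectors and matrices\<close>

definition outer_prod :: "real vec \<Rightarrow> real vec \<Rightarrow> real mat" where
  "outer_prod u v = mat (dim_vec u) (dim_vec v) (\<lambda>(k, l). u $ k * v $ l)"

definition mat_trace :: "real mat \<Rightarrow> real" where
  "mat_trace A = (\<Sum>k<dim_row A. A $$ (k, k))"

definition psd :: "nat \<Rightarrow> real mat \<Rightarrow> bool" where
  "psd n A \<longleftrightarrow> A \<in> carrier_mat n n \<and> transpose_mat A = A \<and>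
    (\<forall>v \<in> carrier_vec n. 0 \<le> v \<bullet> (A *\<^sub>v v))"

definition completely_positive_cone :: "nat \<Rightarrow> real mat set" where
  "completely_positive_cone n =
    {Y * transpose_mat Y | Y. \<exists>r. Y \<in> carrier_mat n r \<and> 0\<^sub>m n r \<le> Y}"

definition bounded_vecs :: "real vec set \<Rightarrow> bool" where
  "bounded_vecs S \<longleftrightarrow> (\<exists>M. \<forall>v \<in> S. sqrt (v \<bullet> v) \<le> M)"


section \<open>Mixed-binary quadratic games\<close>

text \<open>
  All vector and matrix indices start at 0. A coordinate of the joint strategy vector
  is a pair \<open>(j, k)\<close> of a player \<open>j\<close> and an index \<open>k < num_vars j\<close>; the matrix
  \<open>quad i\<close> and the vector \<open>lin i\<close>, both of order \<open>\<Sum>j. num_vars j\<close>, are indexed by these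
  pairs, so that the blocks for the partition into player \<open>i\<close> and the other players are
  restrictions of the index sets. Values at other indices are irrelevant.
\<close>

record 'p mbq_game =
  players :: "'p set"
  num_vars :: "'p \<Rightarrow> nat"
  num_eqs :: "'p \<Rightarrow> nat"
  eq_lhs :: "'p \<Rightarrow> nat \<Rightarrow> real vec"
  eq_rhs :: "'p \<Rightarrow> nat \<Rightarrow> real"
  binaries :: "'p \<Rightarrow> nat set"
  quad :: "'p \<Rightarrow> 'p \<times> nat \<Rightarrow> 'p \<times> nat \<Rightarrow> real"
  lin :: "'p \<Rightarrow> 'p \<times> nat \<Rightarrow> real"

definition coords :: "'p mbq_game \<Rightarrow> ('p \<times> nat) set" where
  "coords G = (SIGMA j : players G. {..<num_vars G j})"

definition own_coords :: "'p mbq_game \<Rightarrow> 'p \<Rightarrow> ('p \<times> nat) set" where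
  "own_coords G i = {p \<in> coords G. fst p = i}"

definition other_coords :: "'p mbq_game \<Rightarrow> 'p \<Rightarrow> ('p \<times> nat) set" where
  "other_coords G i = {p \<in> coords G. fst p \<noteq> i}"

definition wf_game :: "'p mbq_game \<Rightarrow> bool" where
  "wf_game G \<longleftrightarrow> finite (players G) \<and>
    (\<forall>i \<in> players G.
      (\<forall>j < num_eqs G i. eq_lhs G i j \<in> carrier_vec (num_vars G i)) \<and>
      binaries G i \<subseteq> {..<num_vars G i} \<and>
      (\<forall>p \<in> coords G. \<forall>q \<in> coords G. quad G i p q = quad G i q p))"

text \<open>\<open>joint x\<close> is the concatenation of the individual strategies.\<close>

definition joint :: "('p \<Rightarrow> real vec) \<Rightarrow> 'p \<times> nat \<Rightarrow> real" where
  "joint x p = x (fst p) $ snd p"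

text \<open>\<open>block_form P M R x\<close> is \<open>x\<^sub>P\<^sup>T M\<^sub>P\<^sub>,\<^sub>R x\<^sub>R\<close> for index sets \<open>P\<close> and \<open>R\<close>.\<close>

definition block_form ::
  "('p \<times> nat) set \<Rightarrow> ('p \<times> nat \<Rightarrow> 'p \<times> nat \<Rightarrow> real) \<Rightarrow> ('p \<times> nat) set \<Rightarrow> ('p \<Rightarrow> real vec) \<Rightarrow> real" where
  "block_form P M R x = (\<Sum>p\<in>P. \<Sum>q\<in>R. joint x p * M p q * joint x q)"

definition own_block :: "'p mbq_game \<Rightarrow> 'p \<Rightarrow> real mat" where
  "own_block G i = mat (num_vars G i) (num_vars G i) (\<lambda>(k, l). quad G i (i, k) (i, l))"

definition lin_form :: "'p mbq_game \<Rightarrow> 'p \<Rightarrow> ('p \<Rightarrow> real vec) \<Rightarrow> real" where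
  "lin_form G i x = (\<Sum>p\<in>coords G. lin G i p * joint x p)"

definition mbqp_cost :: "'p mbq_game \<Rightarrow> 'p \<Rightarrow> ('p \<Rightarrow> real vec) \<Rightarrow> real" where
  "mbqp_cost G i x = block_form (coords G) (quad G i) (coords G) x + 2 * lin_form G i x"

definition linear_relaxation :: "'p mbq_game \<Rightarrow> 'p \<Rightarrow> real vec set" where
  "linear_relaxation G i = {v \<in> carrier_vec (num_vars G i).
    (\<forall>j < num_eqs G i. eq_lhs G i j \<bullet> v = eq_rhs G i j) \<and> 0\<^sub>v (num_vars G i) \<le> v}"

definition mbqp_strategies :: "'p mbq_game \<Rightarrow> 'p \<Rightarrow> real vec set" where
  "mbqp_strategies G i = {v \<in> linear_relaxation G i. \<forall>k \<in> binaries G i. v $ k \<in> {0, 1}}"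

text \<open>
  Optimal values are infima in the extended reals, so that infeasible and unbounded
  problems also have one. Replacing the \<open>i\<close>-th component of \<open>x\<close> makes the value depend
  on \<open>x\<close> only through the strategies of the other players.
\<close>

definition mbqp_opt :: "'p mbq_game \<Rightarrow> 'p \<Rightarrow> ('p \<Rightarrow> real vec) \<Rightarrow> ereal" where
  "mbqp_opt G i x = (INF v \<in> mbqp_strategies G i. ereal (mbqp_cost G i (x(i := v))))"

definition mbqp_pne :: "'p mbq_game \<Rightarrow> ('p \<Rightarrow> real vec) \<Rightarrow> bool" where
  "mbqp_pne G x \<longleftrightarrow> (\<forall>i \<in> players G.
    x i \<in> mbqp_strategies G i \<and> ereal (mbqp_cost G i x) = mbqp_opt G i x)"


section \<open>The property (KP) and the condition on the binary variables\<close>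

definition kp_vec :: "'p mbq_game \<Rightarrow> 'p \<Rightarrow> real vec \<Rightarrow> real vec" where
  "kp_vec G i y = vec (num_vars G i) (\<lambda>l. \<Sum>j<num_eqs G i. y $ j * eq_lhs G i j $ l)"

definition kp_multiplier :: "'p mbq_game \<Rightarrow> 'p \<Rightarrow> real vec \<Rightarrow> bool" where
  "kp_multiplier G i y \<longleftrightarrow> y \<in> carrier_vec (num_eqs G i) \<and>
    0\<^sub>v (num_vars G i) \<le> kp_vec G i y \<and> (\<Sum>j<num_eqs G i. y $ j * eq_rhs G i j) = 1"

text \<open>
  The standing assumption of Burer's theorem on completely positive reformulations:
  the linear constraints alone imply that the binary variables lie in \<open>[0, 1]\<close>
  (nonnegativity is part of \<open>linear_relaxation\<close>). Boundedness of the strategy sets and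
  (KP) do not imply it, and without it the optimal value of the reformulation can be
  strictly smaller than that of the mixed-binary problem.
\<close>

definition binaries_le_one :: "'p mbq_game \<Rightarrow> 'p \<Rightarrow> bool" where
  "binaries_le_one G i \<longleftrightarrow> (\<forall>v \<in> linear_relaxation G i. \<forall>k \<in> binaries G i. v $ k \<le> 1)"


section \<open>The completely positive reformulation\<close>

text \<open>In this section \<open>\<alpha>\<close> assigns to each player the vector \<open>\<Sum>j. y\<^sub>j a\<^sub>j\<close> from (KP).\<close>

definition cpp_cost :: "'p mbq_game \<Rightarrow> 'p \<Rightarrow> ('p \<Rightarrow> real vec \<times> real mat) \<Rightarrow> real" where
  "cpp_cost G i s = (let x = fst \<circ> s; X = snd (s i) in
    mat_trace (own_block G i * X)
    + 2 * block_form (other_coords G i) (quad G i) (own_coords G i) x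
    + block_form (other_coords G i) (quad G i) (other_coords G i) x
    + 2 * lin_form G i x)"

definition cpp_strategies ::
  "'p mbq_game \<Rightarrow> ('p \<Rightarrow> real vec) \<Rightarrow> 'p \<Rightarrow> (real vec \<times> real mat) set" where
  "cpp_strategies G \<alpha> i = {(v, X).
    v \<in> carrier_vec (num_vars G i) \<and> X \<in> carrier_mat (num_vars G i) (num_vars G i) \<and> transpose_mat X = X \<and>
    (\<forall>j < num_eqs G i. eq_lhs G i j \<bullet> v = eq_rhs G i j \<and>
      eq_lhs G i j \<bullet> (X *\<^sub>v eq_lhs G i j) = (eq_rhs G i j)\<^sup>2) \<and>
    (\<forall>k \<in> binaries G i. v $ k = X $$ (k, k)) \<and>
    (\<forall>l < num_vars G i. let e = unit_vec (num_vars G i) l in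
      v $ l = mat_trace (((1 / 2) \<cdot>\<^sub>m (outer_prod (\<alpha> i) e + outer_prod e (\<alpha> i))) * X)) \<and>
    X \<in> completely_positive_cone (num_vars G i)}"

definition cpp_opt ::
  "'p mbq_game \<Rightarrow> ('p \<Rightarrow> real vec) \<Rightarrow> 'p \<Rightarrow> ('p \<Rightarrow> real vec \<times> real mat) \<Rightarrow> ereal" where
  "cpp_opt G \<alpha> i s = (INF t \<in> cpp_strategies G \<alpha> i. ereal (cpp_cost G i (s(i := t))))"

definition cpp_pne ::
  "'p mbq_game \<Rightarrow> ('p \<Rightarrow> real vec) \<Rightarrow> ('p \<Rightarrow> real vec \<times> real mat) \<Rightarrow> bool" where
  "cpp_pne G \<alpha> s \<longleftrightarrow> (\<forall>i \<in> players G.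
    s i \<in> cpp_strategies G \<alpha> i \<and> ereal (cpp_cost G i s) = cpp_opt G \<alpha> i s)"

end

theory Submission
  imports Defs
begin

text \<open>
The idea is to read the completely positive matrix of a strategy as a mixture of rank-one
matrices. Write \<open>X = \<Sum>\<^sub>t z\<^sub>t z\<^sub>t\<^sup>T\<close> with \<open>z\<^sub>t \<ge> 0\<close> and put \<open>w\<^sub>t = \<alpha>\<^sup>T z\<^sub>t \<ge> 0\<close>. The trace constraints of
the reformulation say that \<open>v = X \<alpha> = \<Sum>\<^sub>t w\<^sub>t z\<^sub>t\<close>, the linear ones together with (KP) give
\<open>\<alpha>\<^sup>T v = 1\<close>, that is, \<open>\<Sum>\<^sub>t w\<^sub>t\<^sup>2 = 1\<close>, and for each constraint \<open>a\<^sup>T v = b\<close> one has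
\<open>\<Sum>\<^sub>t (a\<^sup>T z\<^sub>t - b w\<^sub>t)\<^sup>2 = b\<^sup>2 - 2 b\<^sup>2 + b\<^sup>2 = 0\<close>. So every \<open>z\<^sub>t\<close> satisfies the constraint
homogenized by \<open>w\<^sub>t\<close> (\<open>cpp_strategy_decomposition\<close>). Both directions of the theorem rest on this.

From the mixed-binary game to the reformulation: where \<open>w\<^sub>t > 0\<close>, the vector \<open>u\<^sub>t = z\<^sub>t / w\<^sub>t\<close> lies in
the linear relaxation; where \<open>w\<^sub>t = 0\<close>, the vector \<open>z\<^sub>t\<close> is a recession direction of it. Such a
direction leaves the binary coordinates fixed, since the relaxation bounds them by 1, so it is
also a recession direction of the bounded set of mixed-binary strategies, and \<open>z\<^sub>t = 0\<close>
(\<open>feasible_ray_eq_zero\<close>). Hence \<open>(v, X)\<close> is the convex combination, with weights \<open>w\<^sub>t\<^sup>2\<close>, of the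
pairs \<open>(u\<^sub>t, u\<^sub>t u\<^sub>t\<^sup>T)\<close>. The condition \<open>v\<^sub>k = X\<^sub>k\<^sub>k\<close> makes the average of \<open>u\<^sub>t\<^sub>k (1 - u\<^sub>t\<^sub>k) \<ge> 0\<close> vanish, so
all \<open>u\<^sub>t\<close> with positive weight are binary where they have to be
(\<open>cpp_strategy_convex_combination\<close>). The cost of the reformulation is affine in the own strategy
and agrees with the original cost on rank-one pairs; therefore no deviation to \<open>(v, X)\<close> is
better than the best deviation to one of the \<open>u\<^sub>t\<close> (\<open>cpp_cost_ge_mbqp_lower_bound\<close>).

Back: for a positive semidefinite own block \<open>Q\<close>, the sum of the
\<open>(z\<^sub>t - w\<^sub>t v)\<^sup>T Q (z\<^sub>t - w\<^sub>t v) \<ge> 0\<close> equals \<open>Tr(Q X) - v\<^sup>T Q v\<close>, so replacing \<open>X\<close> by \<open>v v\<^sup>T\<close> does not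
increase the cost (\<open>mbqp_cost_le_cpp_cost\<close>). Since \<open>v\<close> is feasible once its binary entries are
integral, and every feasible point of the mixed-binary problem lifts to a rank-one strategy of
the same cost, the equilibrium inequality descends.
\<close>

section \<open>Sums of rank-one matrices\<close>

text \<open>
The matrix \<open>\<Sum>\<^sub>t z\<^sub>t z\<^sub>t\<^sup>T\<close>. Compared with the factorization \<open>Y Y\<^sup>T\<close> it gives access to the single
columns, each of which will become a point of the mixed-binary problem.
\<close>

definition gram_sum :: "nat \<Rightarrow> nat \<Rightarrow> (nat \<Rightarrow> real vec) \<Rightarrow> real mat" where
  "gram_sum n r z = mat n n (\<lambda>(k, l). \<Sum>t<r. z t $ k * z t $ l)"

lemma zero_vec_le_iff:
  "v \<in> carrier_vec n \<Longrightarrow> 0\<^sub>v n \<le> v \<longleftrightarrow> (\<forall>k<n. 0 \<le> v $ k)"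
  by (auto simp: less_eq_vec_def)

lemma gram_sum_carrier [simp]: "gram_sum n r z \<in> carrier_mat n n"
  by (simp add: gram_sum_def)

lemma transpose_gram_sum: "transpose_mat (gram_sum n r z) = gram_sum n r z"
  by (rule eq_matI) (auto simp: gram_sum_def mult.commute)

lemma completely_positive_cone_iff_gram_sum:
  "X \<in> completely_positive_cone n \<longleftrightarrow>
    (\<exists>r z. (\<forall>t<r. z t \<in> carrier_vec n \<and> 0\<^sub>v n \<le> z t) \<and> X = gram_sum n r z)"
  (is "_ \<longleftrightarrow> ?R")
proof
  assume "X \<in> completely_positive_cone n"
  then obtain Y r where Y: "Y \<in> carrier_mat n r" "0\<^sub>m n r \<le> Y" "X = Y * transpose_mat Y"
    by (auto simp: completely_positive_cone_def)
  have "X = gram_sum n r (col Y)"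
    unfolding Y(3) using Y(1)
    by (intro eq_matI) (auto simp: gram_sum_def scalar_prod_def atLeast0LessThan intro!: sum.cong)
  moreover have "\<forall>t<r. col Y t \<in> carrier_vec n \<and> 0\<^sub>v n \<le> col Y t"
    using Y(1,2) by (auto simp: less_eq_vec_def less_eq_mat_def)
  ultimately show ?R by blast
next
  assume ?R
  then obtain r z where z: "\<forall>t<r. z t \<in> carrier_vec n \<and> 0\<^sub>v n \<le> z t" and X: "X = gram_sum n r z"
    by blast
  define Y where "Y = mat n r (\<lambda>(k, t). z t $ k)"
  have "X = Y * transpose_mat Y"
    unfolding X
    by (rule eq_matI) (auto simp: gram_sum_def Y_def scalar_prod_def atLeast0LessThan)
  moreover have "Y \<in> carrier_mat n r"
    by (simp add: Y_def)
  moreover have "0\<^sub>m n r \<le> Y"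
    using z by (auto simp: less_eq_mat_def Y_def zero_vec_le_iff)
  ultimately show "X \<in> completely_positive_cone n"
    unfolding completely_positive_cone_def by (intro CollectI exI conjI)
qed

lemma outer_prod_self_eq_gram_sum:
  assumes "v \<in> carrier_vec n"
  shows "outer_prod v v = gram_sum n 1 (\<lambda>_. v)"
  using assms by (auto simp: outer_prod_def gram_sum_def)

lemma scalar_prod_sum:
  assumes "(v :: real vec) \<in> carrier_vec n"
  shows "u \<bullet> v = (\<Sum>k<n. u $ k * v $ k)"
  using assms by (auto simp: scalar_prod_def atLeast0LessThan)

lemma bilinear_form_sum:
  assumes "A \<in> carrier_mat n n" "v \<in> carrier_vec n"
  shows "u \<bullet> (A *\<^sub>v v) = (\<Sum>k<n. \<Sum>l<n. u $ k * (A $$ (k, l) :: real) * v $ l)"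
proof -
  have "u \<bullet> (A *\<^sub>v v) = (\<Sum>k<n. u $ k * (A *\<^sub>v v) $ k)"
    using assms by (intro scalar_prod_sum) auto
  also have "\<dots> = (\<Sum>k<n. u $ k * (\<Sum>l<n. A $$ (k, l) * v $ l))"
    using assms by (intro sum.cong) (auto simp: scalar_prod_sum[of v n])
  finally show ?thesis by (simp add: sum_distrib_left mult.assoc)
qed

lemma trace_mult_gram_sum:
  assumes A: "A \<in> carrier_mat n n" and z: "\<forall>t<r. z t \<in> carrier_vec n"
  shows "mat_trace (A * gram_sum n r z) = (\<Sum>t<r. z t \<bullet> (A *\<^sub>v z t))"
proof -
  have "mat_trace (A * gram_sum n r z)
      = (\<Sum>k<n. \<Sum>l<n. \<Sum>t<r. z t $ k * A $$ (k, l) * z t $ l)"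
    using A by (auto simp: mat_trace_def gram_sum_def scalar_prod_def atLeast0LessThan
        sum_distrib_left ac_simps intro!: sum.cong)
  also have "\<dots> = (\<Sum>k<n. \<Sum>t<r. \<Sum>l<n. z t $ k * A $$ (k, l) * z t $ l)"
    by (rule sum.cong[OF refl], rule sum.swap)
  also have "\<dots> = (\<Sum>t<r. \<Sum>k<n. \<Sum>l<n. z t $ k * A $$ (k, l) * z t $ l)"
    by (rule sum.swap)
  also have "\<dots> = (\<Sum>t<r. z t \<bullet> (A *\<^sub>v z t))"
    using A z by (intro sum.cong) (auto simp: bilinear_form_sum[of A n])
  finally show ?thesis .
qed

lemma quadratic_form_gram_sum:
  assumes a: "a \<in> carrier_vec n" and z: "\<forall>t<r. z t \<in> carrier_vec n"
  shows "a \<bullet> (gram_sum n r z *\<^sub>v a) = (\<Sum>t<r. (a \<bullet> z t)\<^sup>2)"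
proof -
  have "a \<bullet> (gram_sum n r z *\<^sub>v a)
      = (\<Sum>k<n. \<Sum>l<n. \<Sum>t<r. (a $ k * z t $ k) * (a $ l * z t $ l))"
    using a by (subst bilinear_form_sum[of _ n])
      (auto simp: gram_sum_def sum_distrib_left sum_distrib_right ac_simps intro!: sum.cong)
  also have "\<dots> = (\<Sum>k<n. \<Sum>t<r. \<Sum>l<n. (a $ k * z t $ k) * (a $ l * z t $ l))"
    by (rule sum.cong[OF refl], rule sum.swap)
  also have "\<dots> = (\<Sum>t<r. \<Sum>k<n. \<Sum>l<n. (a $ k * z t $ k) * (a $ l * z t $ l))"
    by (rule sum.swap)
  also have "\<dots> = (\<Sum>t<r. (a \<bullet> z t)\<^sup>2)"
    using z by (intro sum.cong) (auto simp: scalar_prod_sum[of _ n] power2_eq_square sum_product)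
  finally show ?thesis .
qed

text \<open>
With \<open>e\<close> a unit vector this evaluates, on a single rank-one summand, the matrix that appears in
the constraint expressing \<open>v = X \<alpha>\<close>.
\<close>

lemma symmetrized_outer_prod_form:
  assumes a: "a \<in> carrier_vec n" and e: "e \<in> carrier_vec n" and v: "v \<in> carrier_vec n"
  shows "v \<bullet> (((1 / 2) \<cdot>\<^sub>m (outer_prod a e + outer_prod e a)) *\<^sub>v v) = (a \<bullet> v) * (e \<bullet> v)"
proof -
  let ?A = "(1 / 2) \<cdot>\<^sub>m (outer_prod a e + outer_prod e a)"
  have A: "?A \<in> carrier_mat n n"
    using a e by (simp add: outer_prod_def)
  have A_entry: "?A $$ (k, m) = (1 / 2) * (a $ k * e $ m + e $ k * a $ m)" if "k < n" "m < n" for k m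
    using a e that by (simp add: outer_prod_def)
  have "v \<bullet> (?A *\<^sub>v v) = (\<Sum>k<n. \<Sum>m<n.
      (1/2) * ((a $ k * v $ k) * (e $ m * v $ m)) + (1/2) * ((e $ k * v $ k) * (a $ m * v $ m)))"
    unfolding bilinear_form_sum[OF A v]
    by (intro sum.cong refl) (simp add: A_entry algebra_simps)
  also have "\<dots> = (1/2) * ((\<Sum>k<n. a $ k * v $ k) * (\<Sum>m<n. e $ m * v $ m))
      + (1/2) * ((\<Sum>k<n. e $ k * v $ k) * (\<Sum>m<n. a $ m * v $ m))"
    by (simp only: sum.distrib sum_distrib_left[symmetric] sum_product)
  also have "\<dots> = (a \<bullet> v) * (e \<bullet> v)"
    by (simp add: scalar_prod_sum[OF v])
  finally show ?thesis .
qed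

lemma trace_symmetrized_outer_prod_gram_sum:
  assumes a: "a \<in> carrier_vec n" and z: "\<forall>t<r. z t \<in> carrier_vec n" and l: "l < n"
  defines "e \<equiv> unit_vec n l"
  shows "mat_trace (((1 / 2) \<cdot>\<^sub>m (outer_prod a e + outer_prod e a)) * gram_sum n r z)
    = (\<Sum>t<r. (a \<bullet> z t) * z t $ l)"
proof -
  have e: "e \<in> carrier_vec n" by (simp add: e_def)
  have "(1 / 2) \<cdot>\<^sub>m (outer_prod a e + outer_prod e a) \<in> carrier_mat n n"
    using a e by (simp add: outer_prod_def)
  then have "mat_trace (((1 / 2) \<cdot>\<^sub>m (outer_prod a e + outer_prod e a)) * gram_sum n r z)
      = (\<Sum>t<r. (a \<bullet> z t) * (e \<bullet> z t))"
    using z by (simp add: trace_mult_gram_sum symmetrized_outer_prod_form[OF a e])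
  then show ?thesis
    using z l by (simp add: e_def scalar_prod_left_unit)
qed

section \<open>The structure of strategies of the reformulation\<close>

lemma scalar_prod_kp_vec:
  assumes "\<forall>j<num_eqs G i. eq_lhs G i j \<in> carrier_vec (num_vars G i)" 
    and v: "v \<in> carrier_vec (num_vars G i)"
  shows "kp_vec G i y \<bullet> v = (\<Sum>j<num_eqs G i. y $ j * (eq_lhs G i j \<bullet> v))"
proof -
  have "kp_vec G i y \<bullet> v = (\<Sum>k<num_vars G i. \<Sum>j<num_eqs G i. y $ j * (eq_lhs G i j $ k * v $ k))"
    using v by (simp add: scalar_prod_sum[OF v] kp_vec_def sum_distrib_right mult.assoc)
  also have "\<dots> = (\<Sum>j<num_eqs G i. \<Sum>k<num_vars G i. y $ j * (eq_lhs G i j $ k * v $ k))"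
    by (rule sum.swap)
  finally show ?thesis by (simp add: scalar_prod_sum[OF v] sum_distrib_left)
qed

lemma scalar_prod_nonneg:
  assumes "0\<^sub>v n \<le> u" "0\<^sub>v n \<le> (v :: real vec)"
  shows "0 \<le> u \<bullet> v"
  using assms by (auto simp: scalar_prod_def less_eq_vec_def intro!: sum_nonneg)

lemma scalar_prod_combination:
  assumes "\<forall>t<r. z t \<in> carrier_vec n" "v \<in> carrier_vec n"
    and "\<forall>l<n. v $ l = (\<Sum>t<r. c t * z t $ l)"
  shows "u \<bullet> v = (\<Sum>t<r. c t * (u \<bullet> z t :: real))"
proof -
  have "u \<bullet> v = (\<Sum>l<n. \<Sum>t<r. c t * (u $ l * z t $ l))"
    using assms by (simp add: scalar_prod_sum[of v n] sum_distrib_left mult.left_commute)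
  also have "\<dots> = (\<Sum>t<r. \<Sum>l<n. c t * (u $ l * z t $ l))"
    by (rule sum.swap)
  finally show ?thesis using assms by (simp add: scalar_prod_sum[of _ n] sum_distrib_left)
qed

text \<open>
Every summand satisfies the linear constraints homogenized by its own weight \<open>\<alpha>\<^sup>T z\<^sub>t\<close>. The
constraints on \<open>v\<close> and on \<open>X\<close> provide the first and second moments of \<open>a\<^sup>T z\<^sub>t\<close> that make
the variance-like sum \<open>\<Sum>\<^sub>t (a\<^sup>T z\<^sub>t - b \<alpha>\<^sup>T z\<^sub>t)\<^sup>2\<close> vanish.
\<close>

lemma cpp_strategy_decomposition:
  assumes lhs: "\<forall>j<num_eqs G i. eq_lhs G i j \<in> carrier_vec (num_vars G i)"
    and kp: "kp_multiplier G i y" and \<alpha>: "\<alpha> i = kp_vec G i y"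
    and vX: "(v, X) \<in> cpp_strategies G \<alpha> i"
  obtains r z where
    "\<forall>t<r. z t \<in> carrier_vec (num_vars G i)"
    "\<forall>t<r. 0\<^sub>v (num_vars G i) \<le> z t"
    "X = gram_sum (num_vars G i) r z"
    "\<forall>l<num_vars G i. v $ l = (\<Sum>t<r. (\<alpha> i \<bullet> z t) * z t $ l)"
    "(\<Sum>t<r. (\<alpha> i \<bullet> z t)\<^sup>2) = 1"
    "\<forall>t<r. 0 \<le> \<alpha> i \<bullet> z t"
    "\<forall>t<r. \<forall>j<num_eqs G i. eq_lhs G i j \<bullet> z t = (\<alpha> i \<bullet> z t) * eq_rhs G i j"
proof -
  let ?n = "num_vars G i" and ?m = "num_eqs G i"
  have v: "v \<in> carrier_vec ?n"
    and eq1: "\<And>j. j < ?m \<Longrightarrow> eq_lhs G i j \<bullet> v = eq_rhs G i j"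
    and eq2: "\<And>j. j < ?m \<Longrightarrow> eq_lhs G i j \<bullet> (X *\<^sub>v eq_lhs G i j) = (eq_rhs G i j)\<^sup>2"
    and X: "X \<in> completely_positive_cone ?n"
    using vX by (auto simp: cpp_strategies_def)
  obtain r z where z: "\<forall>t<r. z t \<in> carrier_vec ?n" "\<forall>t<r. 0\<^sub>v ?n \<le> z t"
    and Xz: "X = gram_sum ?n r z"
    using X unfolding completely_positive_cone_iff_gram_sum by blast
  have a: "\<alpha> i \<in> carrier_vec ?n" and a0: "0\<^sub>v ?n \<le> \<alpha> i"
    using \<alpha> kp by (auto simp: kp_vec_def kp_multiplier_def)
  have vz: "v $ l = (\<Sum>t<r. (\<alpha> i \<bullet> z t) * z t $ l)" if "l < ?n" for l
    using vX that trace_symmetrized_outer_prod_gram_sum[OF a z(1) that]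
    by (auto simp: cpp_strategies_def Let_def Xz)
  have sv: "u \<bullet> v = (\<Sum>t<r. (\<alpha> i \<bullet> z t) * (u \<bullet> z t))" for u
    using scalar_prod_combination[of r z ?n v "\<lambda>t. \<alpha> i \<bullet> z t"] z(1) v vz by blast
  have "\<alpha> i \<bullet> v = 1"
    using kp eq1 unfolding \<alpha> scalar_prod_kp_vec[OF lhs v] kp_multiplier_def by simp
  then have one: "(\<Sum>t<r. (\<alpha> i \<bullet> z t)\<^sup>2) = 1"
    by (simp add: sv power2_eq_square)
  have eqz: "eq_lhs G i j \<bullet> z t = (\<alpha> i \<bullet> z t) * eq_rhs G i j" if t: "t < r" and j: "j < ?m" for t j
  proof -
    let ?u = "\<lambda>t. eq_lhs G i j \<bullet> z t" and ?w = "\<lambda>t. \<alpha> i \<bullet> z t" and ?b = "eq_rhs G i j"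
    have 1: "(\<Sum>t<r. (?u t)\<^sup>2) = ?b\<^sup>2"
      using eq2[OF j] quadratic_form_gram_sum[OF _ z(1), of "eq_lhs G i j"] lhs j by (simp add: Xz)
    have 2: "(\<Sum>t<r. ?w t * ?u t) = ?b"
      using eq1[OF j] by (simp add: sv)
    have "(\<Sum>t<r. (?u t - ?w t * ?b)\<^sup>2)
        = (\<Sum>t<r. (?u t)\<^sup>2 - 2 * ?b * (?w t * ?u t) + ?b\<^sup>2 * (?w t)\<^sup>2)"
      by (intro sum.cong) (auto simp: power2_eq_square algebra_simps)
    also have "\<dots> = (\<Sum>t<r. (?u t)\<^sup>2) - 2 * ?b * (\<Sum>t<r. ?w t * ?u t) + ?b\<^sup>2 * (\<Sum>t<r. (?w t)\<^sup>2)"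
      by (simp only: sum.distrib sum_subtractf sum_distrib_left)
    also have "\<dots> = 0"
      unfolding 1 2 one by (simp add: power2_eq_square)
    finally have "\<forall>t\<in>{..<r}. (?u t - ?w t * ?b)\<^sup>2 = 0"
      by (subst (asm) sum_nonneg_eq_0_iff) auto
    with t show ?thesis by auto
  qed
  show thesis
    by (rule that[of r z]) (use z Xz vz one eqz scalar_prod_nonneg[OF a0] in auto)
qed

text \<open>
The constraint \<open>v = X \<alpha>\<close> holds for \<open>X = v v\<^sup>T\<close> because (KP) normalizes \<open>\<alpha>\<^sup>T v\<close> to 1, and
\<open>v\<^sub>k = X\<^sub>k\<^sub>k\<close> because 0 and 1 are their own squares.
\<close>

lemma rank_one_cpp_strategy:
  assumes lhs: "\<forall>j<num_eqs G i. eq_lhs G i j \<in> carrier_vec (num_vars G i)"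
    and bin: "binaries G i \<subseteq> {..<num_vars G i}"
    and kp: "kp_multiplier G i y" and \<alpha>: "\<alpha> i = kp_vec G i y"
    and vS: "v \<in> mbqp_strategies G i"
  shows "(v, outer_prod v v) \<in> cpp_strategies G \<alpha> i"
proof -
  let ?n = "num_vars G i" and ?m = "num_eqs G i"
  have v: "v \<in> carrier_vec ?n" and v0: "0\<^sub>v ?n \<le> v"
    and eq1: "\<And>j. j < ?m \<Longrightarrow> eq_lhs G i j \<bullet> v = eq_rhs G i j"
    and b: "\<And>k. k \<in> binaries G i \<Longrightarrow> v $ k \<in> {0, 1}"
    using vS by (auto simp: mbqp_strategies_def linear_relaxation_def)
  note X = outer_prod_self_eq_gram_sum[OF v]
  have a: "\<alpha> i \<in> carrier_vec ?n" using \<alpha> by (auto simp: kp_vec_def)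
  have av: "\<alpha> i \<bullet> v = 1"
    using kp eq1 unfolding \<alpha> scalar_prod_kp_vec[OF lhs v] kp_multiplier_def by simp
  have 1: "outer_prod v v \<in> completely_positive_cone ?n"
    unfolding completely_positive_cone_iff_gram_sum X
    using v v0 by (intro exI[of _ 1] exI[of _ "\<lambda>_. v"]) simp
  have 2: "eq_lhs G i j \<bullet> (outer_prod v v *\<^sub>v eq_lhs G i j) = (eq_rhs G i j)\<^sup>2" if "j < ?m" for j
    unfolding X using that lhs v eq1 by (simp add: quadratic_form_gram_sum)
  have 3: "v $ k = outer_prod v v $$ (k, k)" if "k \<in> binaries G i" for k
    using b[OF that] v bin that by (auto simp: outer_prod_def)
  have 4: "v $ l = mat_trace (((1 / 2) \<cdot>\<^sub>m (outer_prod (\<alpha> i) (unit_vec ?n l)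
      + outer_prod (unit_vec ?n l) (\<alpha> i))) * outer_prod v v)" if "l < ?n" for l
    unfolding X using a v that av by (simp add: trace_symmetrized_outer_prod_gram_sum)
  have 5: "outer_prod v v \<in> carrier_mat ?n ?n" "transpose_mat (outer_prod v v) = outer_prod v v"
    unfolding X by (simp_all add: transpose_gram_sum)
  show ?thesis
    unfolding cpp_strategies_def Let_def mem_Collect_eq prod.case
    using v eq1 1 2 3 4 5 by blast
qed

section \<open>Both costs as functions of the own strategy\<close>

text \<open>
For fixed strategies of the others, both costs consist of a part that is quadratic in the own
strategy (or linear in its matrix), the linear part with the coefficients \<open>own_coeff\<close>, and the
constant \<open>others_cost\<close>.
\<close>

definition own_coeff :: "'p mbq_game \<Rightarrow> 'p \<Rightarrow> ('p \<Rightarrow> real vec) \<Rightarrow> real vec" where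
  "own_coeff G i x = vec (num_vars G i) (\<lambda>k.
    2 * (\<Sum>p\<in>other_coords G i. joint x p * quad G i p (i, k)) + 2 * lin G i (i, k))"

definition others_cost :: "'p mbq_game \<Rightarrow> 'p \<Rightarrow> ('p \<Rightarrow> real vec) \<Rightarrow> real" where
  "others_cost G i x = block_form (other_coords G i) (quad G i) (other_coords G i) x
    + 2 * (\<Sum>p\<in>other_coords G i. lin G i p * joint x p)"

lemma joint_fun_upd_other: "p \<in> other_coords G i \<Longrightarrow> joint (x(i := v)) p = joint x p"
  by (auto simp: joint_def other_coords_def)

lemma own_coeff_fun_upd [simp]: "own_coeff G i (x(i := v)) = own_coeff G i x"
  by (simp add: own_coeff_def joint_fun_upd_other cong: sum.cong)

lemma others_cost_fun_upd [simp]: "others_cost G i (x(i := v)) = others_cost G i x"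
  by (simp add: others_cost_def block_form_def joint_fun_upd_other cong: sum.cong)

lemma sum_own_coords:
  assumes "i \<in> players G"
  shows "sum f (own_coords G i) = (\<Sum>k<num_vars G i. f (i, k))"
proof -
  have "own_coords G i = Pair i ` {..<num_vars G i}"
    using assms by (auto simp: own_coords_def coords_def)
  then show ?thesis by (simp add: sum.reindex inj_on_def)
qed

lemma sum_coords_split:
  assumes "wf_game G" "i \<in> players G"
  shows "sum f (coords G) = (\<Sum>k<num_vars G i. f (i, k)) + sum f (other_coords G i)"
proof -
  have "finite (coords G)"
    using assms by (auto simp: wf_game_def coords_def)
  then have "sum f (coords G) = sum f (own_coords G i) + sum f (other_coords G i)"
    by (subst sum.union_disjoint[symmetric])
      (auto simp: own_coords_def other_coords_def intro: sum.cong)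
  then show ?thesis by (simp add: sum_own_coords[OF assms(2)])
qed

lemma cross_terms_eq:
  assumes wf: "wf_game G" and i: "i \<in> players G" and xi: "x i \<in> carrier_vec (num_vars G i)"
  shows "2 * block_form (other_coords G i) (quad G i) (own_coords G i) x
    + block_form (other_coords G i) (quad G i) (other_coords G i) x + 2 * lin_form G i x
    = own_coeff G i x \<bullet> x i + others_cost G i x"
proof -
  have "block_form (other_coords G i) (quad G i) (own_coords G i) x
      = (\<Sum>k<num_vars G i. \<Sum>p\<in>other_coords G i. joint x p * quad G i p (i, k) * x i $ k)"
    unfolding block_form_def sum_own_coords[OF i] by (subst sum.swap) (simp add: joint_def)
  then show ?thesis
    by (simp add: scalar_prod_sum[OF xi] own_coeff_def others_cost_def lin_form_def
        sum_coords_split[OF wf i] sum.distrib sum_distrib_left sum_distrib_right joint_def algebra_simps)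
qed

lemma cpp_cost_eq:
  assumes "wf_game G" "i \<in> players G" "fst (s i) \<in> carrier_vec (num_vars G i)"
  shows "cpp_cost G i s = mat_trace (own_block G i * snd (s i))
    + own_coeff G i (fst \<circ> s) \<bullet> fst (s i) + others_cost G i (fst \<circ> s)"
  using cross_terms_eq[of G i "fst \<circ> s"] assms by (simp add: cpp_cost_def Let_def)

text \<open>
The two mixed blocks of the quadratic form agree by symmetry of the matrix; together they
account for the factor 2 of the mixed term in the reformulated cost.
\<close>

lemma mbqp_cost_eq:
  assumes wf: "wf_game G" and i: "i \<in> players G" and xi: "x i \<in> carrier_vec (num_vars G i)"
  shows "mbqp_cost G i x = x i \<bullet> (own_block G i *\<^sub>v x i)
    + own_coeff G i x \<bullet> x i + others_cost G i x"
proof -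
  let ?O = "other_coords G i" and ?n = "num_vars G i" and ?Q = "quad G i"
  have sym: "?Q p q = ?Q q p" if "p \<in> coords G" "q \<in> coords G" for p q
    using wf i that by (auto simp: wf_game_def)
  have "(\<Sum>k<?n. \<Sum>q\<in>?O. joint x (i, k) * ?Q (i, k) q * joint x q)
      = (\<Sum>k<?n. \<Sum>q\<in>?O. joint x q * ?Q q (i, k) * joint x (i, k))"
  proof (intro sum.cong refl)
    fix k q assume "k \<in> {..<?n}" "q \<in> ?O"
    then have "?Q (i, k) q = ?Q q (i, k)"
      using i by (intro sym) (auto simp: coords_def other_coords_def)
    then show "joint x (i, k) * ?Q (i, k) q * joint x q = joint x q * ?Q q (i, k) * joint x (i, k)"
      by simp
  qed
  also have "\<dots> = block_form ?O ?Q (own_coords G i) x"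
    unfolding block_form_def sum_own_coords[OF i] by (subst sum.swap) simp
  finally have own_other: "(\<Sum>k<?n. \<Sum>q\<in>?O. joint x (i, k) * ?Q (i, k) q * joint x q)
      = block_form ?O ?Q (own_coords G i) x" .
  have "own_block G i \<in> carrier_mat ?n ?n"
    by (simp add: own_block_def)
  from bilinear_form_sum[OF this xi, of "x i"]
  have own_own: "x i \<bullet> (own_block G i *\<^sub>v x i)
      = (\<Sum>k<?n. \<Sum>l<?n. joint x (i, k) * ?Q (i, k) (i, l) * joint x (i, l))"
    by (simp add: own_block_def joint_def)
  have "block_form (coords G) ?Q (coords G) x = x i \<bullet> (own_block G i *\<^sub>v x i)
      + 2 * block_form ?O ?Q (own_coords G i) x + block_form ?O ?Q ?O x"
    using own_other unfolding own_own block_form_def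
    by (simp add: sum_coords_split[OF wf i] sum_own_coords[OF i] sum.distrib)
  then show ?thesis
    using cross_terms_eq[OF wf i, of x] xi by (simp add: mbqp_cost_def)
qed

text \<open>
On rank-one pairs the linearized quadratic term is exact, so the lifting preserves costs.
\<close>

lemma cpp_cost_rank_one:
  assumes "wf_game G" "i \<in> players G" "fst (s i) \<in> carrier_vec (num_vars G i)"
    and "snd (s i) = outer_prod (fst (s i)) (fst (s i))"
  shows "cpp_cost G i s = mbqp_cost G i (fst \<circ> s)"
proof -
  have "mat_trace (own_block G i * outer_prod (fst (s i)) (fst (s i)))
      = fst (s i) \<bullet> (own_block G i *\<^sub>v fst (s i))"
    unfolding outer_prod_self_eq_gram_sum[OF assms(3)]
    by (subst trace_mult_gram_sum) (use assms(3) in \<open>auto simp: own_block_def\<close>)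
  then show ?thesis using assms by (simp add: cpp_cost_eq mbqp_cost_eq)
qed

section \<open>Rounding down to rank one for convex costs\<close>

text \<open>
A matrix form of Jensen's inequality: the difference of the two sides is the sum of the values of the
form at \<open>z\<^sub>t - w\<^sub>t v\<close>. Where the weights are nonzero, \<open>v\<close> is the mean of the points \<open>z\<^sub>t / w\<^sub>t\<close>
with the probabilities \<open>w\<^sub>t\<^sup>2\<close>.
\<close>

lemma psd_quadratic_form_le:
  assumes psd: "psd n A" and z: "\<forall>t<r. z t \<in> carrier_vec n" and v: "v \<in> carrier_vec n"
    and vz: "\<forall>l<n. v $ l = (\<Sum>t<r. w t * z t $ l)" and w: "(\<Sum>t<r. (w t)\<^sup>2) = 1"
  shows "v \<bullet> (A *\<^sub>v v) \<le> (\<Sum>t<r. z t \<bullet> (A *\<^sub>v z t))"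
proof -
  have A: "A \<in> carrier_mat n n" and At: "transpose_mat A = A"
    and A0: "\<And>u. u \<in> carrier_vec n \<Longrightarrow> 0 \<le> u \<bullet> (A *\<^sub>v u)"
    using psd by (auto simp: psd_def)
  have Av: "A *\<^sub>v u \<in> carrier_vec n" if "u \<in> carrier_vec n" for u
    using A that by auto
  have sym: "u \<bullet> (A *\<^sub>v u') = u' \<bullet> (A *\<^sub>v u)" if "u \<in> carrier_vec n" "u' \<in> carrier_vec n" for u u'
    using transpose_vec_mult_scalar[OF A that] comm_scalar_prod[OF that(1) Av[OF that(2)]]
      At comm_scalar_prod[OF that(2) Av[OF that(1)]] by metis
  let ?d = "\<lambda>t. z t - w t \<cdot>\<^sub>v v"
  have expand: "?d t \<bullet> (A *\<^sub>v ?d t)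
      = z t \<bullet> (A *\<^sub>v z t) - 2 * (w t * ((A *\<^sub>v v) \<bullet> z t)) + (w t)\<^sup>2 * (v \<bullet> (A *\<^sub>v v))" if t: "t < r" for t
  proof -
    have zt: "z t \<in> carrier_vec n" using z t by blast
    have "A *\<^sub>v ?d t = A *\<^sub>v z t - w t \<cdot>\<^sub>v (A *\<^sub>v v)"
      using A zt v by (simp add: mult_minus_distrib_mat_vec mult_mat_vec)
    moreover have "z t \<bullet> (A *\<^sub>v v) = v \<bullet> (A *\<^sub>v z t)" "(A *\<^sub>v v) \<bullet> z t = v \<bullet> (A *\<^sub>v z t)"
      using sym[OF zt v] comm_scalar_prod[OF zt Av[OF v]] by simp_all
    ultimately show ?thesis
      using zt v Av[OF v] Av[OF zt]
      by (simp add: minus_scalar_prod_distrib[of _ n] scalar_prod_minus_distrib[of _ n]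
          power2_eq_square algebra_simps)
  qed
  have "0 \<le> (\<Sum>t<r. ?d t \<bullet> (A *\<^sub>v ?d t))"
    using z v by (intro sum_nonneg A0) auto
  also have "\<dots> = (\<Sum>t<r. z t \<bullet> (A *\<^sub>v z t)) - 2 * (\<Sum>t<r. w t * ((A *\<^sub>v v) \<bullet> z t))
      + (\<Sum>t<r. (w t)\<^sup>2) * (v \<bullet> (A *\<^sub>v v))"
    by (simp add: expand sum.distrib sum_subtractf sum_distrib_left sum_distrib_right)
  also have "(\<Sum>t<r. w t * ((A *\<^sub>v v) \<bullet> z t)) = (A *\<^sub>v v) \<bullet> v"
    using scalar_prod_combination[OF z v vz] by simp
  also have "(A *\<^sub>v v) \<bullet> v = v \<bullet> (A *\<^sub>v v)"
    using comm_scalar_prod[OF v Av[OF v]] by simp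
  finally show ?thesis using w by simp
qed

lemma mbqp_cost_le_cpp_cost:
  assumes wf: "wf_game G" and i: "i \<in> players G"
    and kp: "kp_multiplier G i y" and \<alpha>: "\<alpha> i = kp_vec G i y"
    and s: "s i \<in> cpp_strategies G \<alpha> i" and psd: "psd (num_vars G i) (own_block G i)"
  shows "mbqp_cost G i (fst \<circ> s) \<le> cpp_cost G i s"
proof -
  let ?n = "num_vars G i"
  obtain v X where vX: "s i = (v, X)" by fastforce
  have lhs: "\<forall>j<num_eqs G i. eq_lhs G i j \<in> carrier_vec ?n"
    using wf i by (auto simp: wf_game_def)
  have v: "v \<in> carrier_vec ?n" using s vX by (auto simp: cpp_strategies_def)
  obtain r z where z: "\<forall>t<r. z t \<in> carrier_vec ?n" and X: "X = gram_sum ?n r z"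
    and vz: "\<forall>l<?n. v $ l = (\<Sum>t<r. (\<alpha> i \<bullet> z t) * z t $ l)"
    and one: "(\<Sum>t<r. (\<alpha> i \<bullet> z t)\<^sup>2) = 1"
    by (rule cpp_strategy_decomposition[OF lhs kp, where \<alpha> = \<alpha>, OF \<alpha> s[unfolded vX]]) blast
  have "v \<bullet> (own_block G i *\<^sub>v v) \<le> (\<Sum>t<r. z t \<bullet> (own_block G i *\<^sub>v z t))"
    by (rule psd_quadratic_form_le[OF psd z v vz one])
  also have "\<dots> = mat_trace (own_block G i * X)"
    unfolding X by (rule trace_mult_gram_sum[OF _ z, symmetric]) (simp add: own_block_def)
  finally show ?thesis
    using wf i v by (simp add: mbqp_cost_eq cpp_cost_eq vX)
qed

text \<open>
Nonnegativity of \<open>v\<close> is not among the constraints of the reformulation; it follows from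
\<open>v = X \<alpha>\<close>, where \<open>X\<close> and \<open>\<alpha>\<close> are nonnegative.
\<close>

lemma cpp_strategy_in_linear_relaxation:
  assumes lhs: "\<forall>j<num_eqs G i. eq_lhs G i j \<in> carrier_vec (num_vars G i)"
    and kp: "kp_multiplier G i y" and \<alpha>: "\<alpha> i = kp_vec G i y"
    and vX: "(v, X) \<in> cpp_strategies G \<alpha> i"
  shows "v \<in> linear_relaxation G i"
proof -
  obtain r z where z: "\<forall>t<r. z t \<in> carrier_vec (num_vars G i)"
    and z0: "\<forall>t<r. 0\<^sub>v (num_vars G i) \<le> z t"
    and "X = gram_sum (num_vars G i) r z"
    and vz: "\<forall>l<num_vars G i. v $ l = (\<Sum>t<r. (\<alpha> i \<bullet> z t) * z t $ l)"
    and w0: "\<forall>t<r. 0 \<le> \<alpha> i \<bullet> z t"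
    by (rule cpp_strategy_decomposition[OF lhs kp, where \<alpha> = \<alpha>, OF \<alpha> vX]) blast
  have "0 \<le> v $ l" if "l < num_vars G i" for l
    unfolding vz[rule_format, OF that] using z0 z w0 that
    by (intro sum_nonneg mult_nonneg_nonneg) (auto simp: zero_vec_le_iff)
  then show ?thesis
    using vX by (auto simp: linear_relaxation_def cpp_strategies_def less_eq_vec_def)
qed

section \<open>Strategies of the reformulation as convex combinations\<close>

text \<open>
Moving along the ray stays in the linear relaxation. As binary coordinates are bounded by 1
there, they are constant along the ray, so the ray stays in the strategy set itself, which is
bounded.
\<close>

lemma feasible_ray_eq_zero:
  assumes bin: "binaries G i \<subseteq> {..<num_vars G i}"
    and bounded: "bounded_vecs (mbqp_strategies G i)" and le_one: "binaries_le_one G i"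
    and u: "u \<in> mbqp_strategies G i"
    and lhs: "\<forall>j<num_eqs G i. eq_lhs G i j \<in> carrier_vec (num_vars G i)"
    and z: "z \<in> carrier_vec (num_vars G i)" and z0: "0\<^sub>v (num_vars G i) \<le> z"
    and az: "\<And>j. j < num_eqs G i \<Longrightarrow> eq_lhs G i j \<bullet> z = 0"
  shows "z = 0\<^sub>v (num_vars G i)"
proof (rule ccontr)
  let ?n = "num_vars G i"
  assume "z \<noteq> 0\<^sub>v ?n"
  then obtain k where k: "k < ?n" "z $ k \<noteq> 0"
    using z by (metis carrier_vecD eq_vecI index_zero_vec)
  with z0 have zk: "0 < z $ k"
    by (auto simp: less_eq_vec_def order_less_le)
  have u': "u \<in> carrier_vec ?n" "0\<^sub>v ?n \<le> u"
    using u by (auto simp: mbqp_strategies_def linear_relaxation_def)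
  have ray: "u + c \<cdot>\<^sub>v z \<in> linear_relaxation G i" if "0 \<le> c" for c
    unfolding linear_relaxation_def
  proof (intro CollectI conjI allI impI)
    show "u + c \<cdot>\<^sub>v z \<in> carrier_vec ?n" using u' z by simp
    show "eq_lhs G i j \<bullet> (u + c \<cdot>\<^sub>v z) = eq_rhs G i j" if "j < num_eqs G i" for j
      using that az[OF that] lhs u u' z
      by (simp add: scalar_prod_add_distrib[of _ ?n] mbqp_strategies_def linear_relaxation_def)
    show "0\<^sub>v ?n \<le> u + c \<cdot>\<^sub>v z"
      using u' z z0 that by (auto simp: less_eq_vec_def)
  qed
  have zb: "z $ b = 0" if b: "b \<in> binaries G i" for b
  proof (rule ccontr)
    assume "z $ b \<noteq> 0"
    have bn: "b < ?n" using b bin by auto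
    with z0 \<open>z $ b \<noteq> 0\<close> have zb: "0 < z $ b" by (auto simp: less_eq_vec_def order_less_le)
    \<comment> \<open>This step length would raise the coordinate \<open>b\<close> by 2.\<close>
    have "(u + (2 / z $ b) \<cdot>\<^sub>v z) $ b \<le> 1"
      using ray[of "2 / z $ b"] zb b le_one by (auto simp: binaries_le_one_def)
    moreover have "0 \<le> u $ b" using u' bn by (auto simp: less_eq_vec_def)
    ultimately show False using zb bn u' z by simp
  qed
  obtain M where M: "\<And>v. v \<in> mbqp_strategies G i \<Longrightarrow> sqrt (v \<bullet> v) \<le> M"
    using bounded by (auto simp: bounded_vecs_def)
  \<comment> \<open>Far enough on the ray the coordinate \<open>k\<close> alone exceeds the bound \<open>M\<close> on the norm.\<close>
  define c where "c = (\<bar>M\<bar> + 1) / z $ k"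
  have c: "0 \<le> c" using zk by (simp add: c_def)
  have mem: "u + c \<cdot>\<^sub>v z \<in> mbqp_strategies G i"
    using ray[OF c] zb bin u u' z by (auto simp: mbqp_strategies_def subset_iff)
  let ?v = "u + c \<cdot>\<^sub>v z"
  have "\<bar>M\<bar> + 1 \<le> ?v $ k"
    using k zk u' z by (auto simp: c_def less_eq_vec_def)
  also have "?v $ k \<le> sqrt (?v \<bullet> ?v)"
  proof (rule real_le_rsqrt)
    have v: "?v \<in> carrier_vec ?n" using u' z by simp
    show "(?v $ k)\<^sup>2 \<le> ?v \<bullet> ?v"
      unfolding scalar_prod_sum[OF v] using k
      by (subst power2_eq_square, intro member_le_sum[of k _ "\<lambda>l. ?v $ l * ?v $ l"]) auto
  qed
  also have "\<dots> \<le> M" by (rule M[OF mem])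
  finally show False by simp
qed

text \<open>
The weights are kept as squares, because \<open>X\<close> is built from the vectors \<open>w\<^sub>t u\<^sub>t\<close>. Binary entries
are integral by the equality case of \<open>u (1 - u) \<ge> 0\<close> on \<open>[0, 1]\<close>.
\<close>

lemma cpp_strategy_convex_combination:
  assumes wf: "wf_game G" and i: "i \<in> players G"
    and bounded: "bounded_vecs (mbqp_strategies G i)" and le_one: "binaries_le_one G i"
    and nonempty: "u0 \<in> mbqp_strategies G i"
    and kp: "kp_multiplier G i y" and \<alpha>: "\<alpha> i = kp_vec G i y"
    and vX: "(v, X) \<in> cpp_strategies G \<alpha> i"
  obtains r w u where
    "\<forall>t<r. u t \<in> mbqp_strategies G i"
    "(\<Sum>t<r. (w t)\<^sup>2) = (1 :: real)"
    "X = gram_sum (num_vars G i) r (\<lambda>t. w t \<cdot>\<^sub>v u t)"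
    "\<forall>l<num_vars G i. v $ l = (\<Sum>t<r. (w t)\<^sup>2 * u t $ l)"
proof -
  let ?n = "num_vars G i"
  have lhs: "\<forall>j<num_eqs G i. eq_lhs G i j \<in> carrier_vec ?n" and bin: "binaries G i \<subseteq> {..<?n}"
    using wf i by (auto simp: wf_game_def)
  obtain r z where "\<forall>t<r. z t \<in> carrier_vec ?n" "\<forall>t<r. 0\<^sub>v ?n \<le> z t"
    and X: "X = gram_sum ?n r z"
    and "\<forall>l<?n. v $ l = (\<Sum>t<r. (\<alpha> i \<bullet> z t) * z t $ l)"
    and one: "(\<Sum>t<r. (\<alpha> i \<bullet> z t)\<^sup>2) = 1"
    and "\<forall>t<r. 0 \<le> \<alpha> i \<bullet> z t"
    and "\<forall>t<r. \<forall>j<num_eqs G i. eq_lhs G i j \<bullet> z t = (\<alpha> i \<bullet> z t) * eq_rhs G i j"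
    by (rule cpp_strategy_decomposition[OF lhs kp, where \<alpha> = \<alpha>, OF \<alpha> vX]) blast
  then have z: "\<And>t. t < r \<Longrightarrow> z t \<in> carrier_vec ?n"
    and z0: "\<And>t. t < r \<Longrightarrow> 0\<^sub>v ?n \<le> z t"
    and vz: "\<And>l. l < ?n \<Longrightarrow> v $ l = (\<Sum>t<r. (\<alpha> i \<bullet> z t) * z t $ l)"
    and w0: "\<And>t. t < r \<Longrightarrow> 0 \<le> \<alpha> i \<bullet> z t"
    and az: "\<And>t j. t < r \<Longrightarrow> j < num_eqs G i \<Longrightarrow> eq_lhs G i j \<bullet> z t = (\<alpha> i \<bullet> z t) * eq_rhs G i j"
    by blast+
  define w where "w t = \<alpha> i \<bullet> z t" for t
  \<comment> \<open>Summands of weight 0 turn out to vanish. Giving them an arbitrary feasible point avoids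
      dropping them from the sums.\<close>
  define u where "u t = (if w t = 0 then u0 else (1 / w t) \<cdot>\<^sub>v z t)" for t
  have u0: "u0 \<in> linear_relaxation G i" "u0 \<in> carrier_vec ?n"
    and u0_bin: "\<And>b. b \<in> binaries G i \<Longrightarrow> u0 $ b \<in> {0, 1}"
    using nonempty by (auto simp: mbqp_strategies_def linear_relaxation_def)
  have zu: "z t = w t \<cdot>\<^sub>v u t" if t: "t < r" for t
  proof (cases "w t = 0")
    case True
    then have "z t = 0\<^sub>v ?n"
      using az[OF t] z[OF t] z0[OF t] feasible_ray_eq_zero[OF bin bounded le_one nonempty lhs]
      by (simp add: w_def)
    then show ?thesis using True u0 by (auto simp: u_def)
  next
    case False
    then show ?thesis by (auto simp: u_def smult_smult_assoc)
  qed
  have u_relax: "u t \<in> linear_relaxation G i" if t: "t < r" for t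
  proof (cases "w t = 0")
    case True
    then show ?thesis using u0 by (simp add: u_def)
  next
    case False
    then have "0 < w t" using w0[OF t] by (simp add: w_def)
    then show ?thesis
      using False z[OF t] z0[OF t] az[OF t] lhs
      by (auto simp: u_def linear_relaxation_def less_eq_vec_def w_def)
  qed
  have u_carrier: "u t \<in> carrier_vec ?n" if "t < r" for t
    using u_relax[OF that] by (simp add: linear_relaxation_def)
  have X_u: "X = gram_sum ?n r (\<lambda>t. w t \<cdot>\<^sub>v u t)"
    unfolding X gram_sum_def using zu by (intro cong_mat refl) (auto intro!: sum.cong)
  have v_u: "v $ l = (\<Sum>t<r. (w t)\<^sup>2 * u t $ l)" if l: "l < ?n" for l
    unfolding vz[OF l]
  proof (intro sum.cong refl)
    fix t assume "t \<in> {..<r}"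
    then have "z t $ l = w t * u t $ l"
      using zu[of t] u_carrier[of t] l by (metis carrier_vecD index_smult_vec(1) lessThan_iff)
    then show "\<alpha> i \<bullet> z t * z t $ l = (w t)\<^sup>2 * u t $ l"
      by (simp add: w_def power2_eq_square)
  qed
  have u_bin: "u t $ b \<in> {0, 1}" if t: "t < r" and b: "b \<in> binaries G i" for t b
  proof (cases "w t = 0")
    case True
    then show ?thesis using u0_bin[OF b] by (simp add: u_def)
  next
    case False
    have bn: "b < ?n" using b bin by auto
    have nonneg: "0 \<le> (w t')\<^sup>2 * (u t' $ b * (1 - u t' $ b))" if "t' < r" for t'
    proof -
      have "0\<^sub>v ?n \<le> u t'" "u t' $ b \<le> 1"
        using u_relax[OF that] le_one b by (auto simp: linear_relaxation_def binaries_le_one_def)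
      then show ?thesis
        using u_carrier[OF that] bn by (simp add: zero_vec_le_iff)
    qed
    have "X $$ (b, b) = (\<Sum>t<r. (w t)\<^sup>2 * (u t $ b * u t $ b))"
      unfolding X_u using bn carrier_vecD[OF u_carrier]
      by (auto simp: gram_sum_def power2_eq_square intro!: sum.cong)
    moreover have "v $ b = X $$ (b, b)" using vX b by (auto simp: cpp_strategies_def)
    ultimately have "(\<Sum>t<r. (w t)\<^sup>2 * (u t $ b * (1 - u t $ b))) = 0"
      using v_u[OF bn] by (simp add: algebra_simps sum_subtractf)
    then have "(w t)\<^sup>2 * (u t $ b * (1 - u t $ b)) = 0"
      using nonneg t by (subst (asm) sum_nonneg_eq_0_iff) auto
    then show ?thesis using False by auto
  qed
  show thesis
    by (rule that[of r u w])
      (use u_relax u_bin one X_u v_u in \<open>auto simp: mbqp_strategies_def w_def\<close>)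
qed

text \<open>
The cost of the reformulation is affine in \<open>(v, X)\<close>, so its value at a convex combination is the
average of its values at the rank-one pairs \<open>(u\<^sub>t, u\<^sub>t u\<^sub>t\<^sup>T)\<close>, which are costs of feasible
mixed-binary deviations.
\<close>

lemma cpp_cost_ge_mbqp_lower_bound:
  assumes wf: "wf_game G" and i: "i \<in> players G"
    and bounded: "bounded_vecs (mbqp_strategies G i)" and le_one: "binaries_le_one G i"
    and nonempty: "mbqp_strategies G i \<noteq> {}"
    and kp: "kp_multiplier G i y" and \<alpha>: "\<alpha> i = kp_vec G i y"
    and s: "s i \<in> cpp_strategies G \<alpha> i"
    and lower: "\<And>v. v \<in> mbqp_strategies G i \<Longrightarrow> c \<le> mbqp_cost G i ((fst \<circ> s)(i := v))"
  shows "c \<le> cpp_cost G i s"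
proof -
  let ?n = "num_vars G i" and ?q = "own_coeff G i (fst \<circ> s)" and ?d = "others_cost G i (fst \<circ> s)"
    and ?A = "own_block G i"
  obtain v X where vX: "s i = (v, X)" by fastforce
  have v: "v \<in> carrier_vec ?n" using s vX by (auto simp: cpp_strategies_def)
  obtain u0 where "u0 \<in> mbqp_strategies G i" using nonempty by blast
  then obtain r w u where u: "\<forall>t<r. u t \<in> mbqp_strategies G i"
    and w: "(\<Sum>t<r. (w t)\<^sup>2) = (1 :: real)"
    and X: "X = gram_sum ?n r (\<lambda>t. w t \<cdot>\<^sub>v u t)"
    and vu: "\<forall>l<?n. v $ l = (\<Sum>t<r. (w t)\<^sup>2 * u t $ l)"
    by (rule cpp_strategy_convex_combination
        [OF wf i bounded le_one _ kp, where \<alpha> = \<alpha>, OF _ \<alpha> s[unfolded vX]]) blast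
  have uc: "u t \<in> carrier_vec ?n" if "t < r" for t
    using u that by (simp add: mbqp_strategies_def linear_relaxation_def)
  have A: "?A \<in> carrier_mat ?n ?n" by (simp add: own_block_def)
  have "mat_trace (?A * X) = (\<Sum>t<r. (w t \<cdot>\<^sub>v u t) \<bullet> (?A *\<^sub>v (w t \<cdot>\<^sub>v u t)))"
    unfolding X using uc by (intro trace_mult_gram_sum[OF A]) auto
  also have "\<dots> = (\<Sum>t<r. (w t)\<^sup>2 * (u t \<bullet> (?A *\<^sub>v u t)))"
    using uc A by (intro sum.cong refl) (simp add: mult_mat_vec[OF A] power2_eq_square)
  finally have trace: "mat_trace (?A * X) = (\<Sum>t<r. (w t)\<^sup>2 * (u t \<bullet> (?A *\<^sub>v u t)))" .
  have linear: "?q \<bullet> v = (\<Sum>t<r. (w t)\<^sup>2 * (?q \<bullet> u t))"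
    by (rule scalar_prod_combination[OF _ v]) (use uc vu in auto)
  have "c = (\<Sum>t<r. (w t)\<^sup>2 * c)"
    using w by (simp add: sum_distrib_right[symmetric])
  also have "\<dots> \<le> (\<Sum>t<r. (w t)\<^sup>2 * (u t \<bullet> (?A *\<^sub>v u t) + ?q \<bullet> u t + ?d))"
  proof (intro sum_mono mult_left_mono)
    fix t assume "t \<in> {..<r}"
    then show "c \<le> u t \<bullet> (?A *\<^sub>v u t) + ?q \<bullet> u t + ?d"
      using lower[of "u t"] u uc[of t] mbqp_cost_eq[OF wf i, of "(fst \<circ> s)(i := u t)"] by simp
  qed simp
  also have "\<dots> = mat_trace (?A * X) + ?q \<bullet> v + (\<Sum>t<r. (w t)\<^sup>2) * ?d"
    unfolding trace linear by (simp add: distrib_left sum.distrib sum_distrib_right)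
  also have "\<dots> = cpp_cost G i s"
    using cpp_cost_eq[OF wf i, of s] v w by (simp add: vX)
  finally show ?thesis .
qed

section \<open>Equilibria\<close>

lemma eq_INF_iff:
  assumes "a \<in> S"
  shows "ereal (f a) = (INF t\<in>S. ereal (f t)) \<longleftrightarrow> (\<forall>t\<in>S. f a \<le> f t)"
proof
  assume "ereal (f a) = (INF t\<in>S. ereal (f t))"
  then show "\<forall>t\<in>S. f a \<le> f t" by (metis INF_lower ereal_less_eq(3))
next
  assume "\<forall>t\<in>S. f a \<le> f t"
  then show "ereal (f a) = (INF t\<in>S. ereal (f t))"
    using assms by (intro antisym INF_greatest INF_lower) auto
qed

lemma mbqp_pne_iff:
  "mbqp_pne G x \<longleftrightarrow> (\<forall>i\<in>players G. x i \<in> mbqp_strategies G i \<and>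
    (\<forall>v\<in>mbqp_strategies G i. mbqp_cost G i x \<le> mbqp_cost G i (x(i := v))))"
  unfolding mbqp_pne_def mbqp_opt_def
  using eq_INF_iff[where f = "\<lambda>v. mbqp_cost G i (x(i := v))" and a = "x i" for i]
  by (intro ball_cong refl conj_cong) simp

lemma cpp_pne_iff:
  "cpp_pne G \<alpha> s \<longleftrightarrow> (\<forall>i\<in>players G. s i \<in> cpp_strategies G \<alpha> i \<and>
    (\<forall>t\<in>cpp_strategies G \<alpha> i. cpp_cost G i s \<le> cpp_cost G i (s(i := t))))"
  unfolding cpp_pne_def cpp_opt_def
  using eq_INF_iff[where f = "\<lambda>t. cpp_cost G i (s(i := t))" and a = "s i" for i]
  by (intro ball_cong refl conj_cong) simp

theorem theorem3:
  fixes G :: "'p mbq_game" and y :: "'p \<Rightarrow> real vec" and \<alpha> :: "'p \<Rightarrow> real vec"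
  assumes "wf_game G"
    and "\<forall>i \<in> players G. bounded_vecs (mbqp_strategies G i)"
    and "\<forall>i \<in> players G. kp_multiplier G i (y i)"
    and "\<forall>i \<in> players G. \<alpha> i = kp_vec G i (y i)"
  shows
    "(\<forall>x. (\<forall>i \<in> players G. binaries_le_one G i) \<longrightarrow> mbqp_pne G x \<longrightarrow>
        cpp_pne G \<alpha> (\<lambda>i. (x i, outer_prod (x i) (x i)))) \<and>
     (\<forall>x X. cpp_pne G \<alpha> (\<lambda>i. (x i, X i)) \<longrightarrow>
        (\<forall>i \<in> players G. psd (num_vars G i) (own_block G i) \<and> (\<forall>k \<in> binaries G i. x i $ k \<in> {0, 1})) \<longrightarrow>
        mbqp_pne G x)"
proof (intro conjI allI impI)
  fix x :: "'p \<Rightarrow> real vec"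
  assume le_one: "\<forall>i\<in>players G. binaries_le_one G i" and pne: "mbqp_pne G x"
  let ?s = "\<lambda>i. (x i, outer_prod (x i) (x i))"
  have fst_s: "fst \<circ> ?s = x" by auto
  show "cpp_pne G \<alpha> ?s"
    unfolding cpp_pne_iff
  proof (intro ballI conjI)
    fix i assume i: "i \<in> players G"
    have lhs: "\<forall>j<num_eqs G i. eq_lhs G i j \<in> carrier_vec (num_vars G i)"
      and bin: "binaries G i \<subseteq> {..<num_vars G i}"
      using assms(1) i by (auto simp: wf_game_def)
    have xi: "x i \<in> mbqp_strategies G i"
      and opt: "\<And>v. v \<in> mbqp_strategies G i \<Longrightarrow> mbqp_cost G i x \<le> mbqp_cost G i (x(i := v))"
      using pne i by (auto simp: mbqp_pne_iff)
    then have xi_carrier: "x i \<in> carrier_vec (num_vars G i)"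
      by (simp add: mbqp_strategies_def linear_relaxation_def)
    have kp: "kp_multiplier G i (y i)" and \<alpha>: "\<alpha> i = kp_vec G i (y i)"
      using assms(3,4) i by auto
    show "?s i \<in> cpp_strategies G \<alpha> i"
      by (rule rank_one_cpp_strategy[where y = "y i", OF lhs bin kp _ xi]) (rule \<alpha>)
    fix t assume t: "t \<in> cpp_strategies G \<alpha> i"
    have "cpp_cost G i ?s = mbqp_cost G i x"
      using cpp_cost_rank_one[OF assms(1) i, of ?s] xi_carrier by (simp add: fst_s)
    also have "\<dots> \<le> cpp_cost G i (?s(i := t))"
    proof (rule cpp_cost_ge_mbqp_lower_bound[where \<alpha> = \<alpha> and y = "y i"])
      have "(fst \<circ> ?s(i := t))(i := v) = x(i := v)" for v by auto
      then show "mbqp_cost G i x \<le> mbqp_cost G i ((fst \<circ> ?s(i := t))(i := v))"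
        if "v \<in> mbqp_strategies G i" for v
        using opt[OF that] by simp
    qed (use assms i le_one xi t in auto)
    finally show "cpp_cost G i ?s \<le> cpp_cost G i (?s(i := t))" .
  qed
next
  fix x :: "'p \<Rightarrow> real vec" and X :: "'p \<Rightarrow> real mat"
  let ?s = "\<lambda>i. (x i, X i)"
  assume pne: "cpp_pne G \<alpha> ?s"
    and psd_bin: "\<forall>i\<in>players G. psd (num_vars G i) (own_block G i) \<and> (\<forall>k\<in>binaries G i. x i $ k \<in> {0, 1})"
  have fst_s: "fst \<circ> ?s = x" by auto
  show "mbqp_pne G x"
    unfolding mbqp_pne_iff
  proof (intro ballI conjI)
    fix i assume i: "i \<in> players G"
    have lhs: "\<forall>j<num_eqs G i. eq_lhs G i j \<in> carrier_vec (num_vars G i)"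
      and bin: "binaries G i \<subseteq> {..<num_vars G i}"
      using assms(1) i by (auto simp: wf_game_def)
    have kp: "kp_multiplier G i (y i)" and \<alpha>: "\<alpha> i = kp_vec G i (y i)"
      using assms(3,4) i by auto
    have si: "?s i \<in> cpp_strategies G \<alpha> i"
      and opt: "\<And>t. t \<in> cpp_strategies G \<alpha> i \<Longrightarrow> cpp_cost G i ?s \<le> cpp_cost G i (?s(i := t))"
      using pne i by (auto simp: cpp_pne_iff)
    show "x i \<in> mbqp_strategies G i"
      using cpp_strategy_in_linear_relaxation[OF lhs kp, where \<alpha> = \<alpha> and v = "x i" and X = "X i"] \<alpha> si psd_bin i
      by (auto simp: mbqp_strategies_def)
    fix v assume v: "v \<in> mbqp_strategies G i"
    have "mbqp_cost G i x \<le> cpp_cost G i ?s"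
      using mbqp_cost_le_cpp_cost[OF assms(1) i kp, where \<alpha> = \<alpha> and s = ?s] \<alpha> si psd_bin i by (simp add: fst_s)
    also have "\<dots> \<le> cpp_cost G i (?s(i := (v, outer_prod v v)))"
      by (rule opt, rule rank_one_cpp_strategy[OF lhs bin kp _ v]) (rule \<alpha>)
    also have "\<dots> = mbqp_cost G i (x(i := v))"
    proof -
      have "fst \<circ> ?s(i := (v, outer_prod v v)) = x(i := v)" by auto
      then show ?thesis
        using cpp_cost_rank_one[OF assms(1) i, of "?s(i := (v, outer_prod v v))"] v
        by (simp add: mbqp_strategies_def linear_relaxation_def)
    qed
    finally show "mbqp_cost G i x \<le> mbqp_cost G i (x(i := v))" .
  qed
qed

end
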